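(* Suppose that assumptions (A1)–(A5) stated in the context hold, and that in the local phase the perturbation parameter is set to $\delta=0$. Then, for sufficiently large $k$, the algorithm SOBASIP described in the context is superlinearly convergent to $x_*$, that is, $$\|x_{k+1}-x_*\|\le O\left(\|x_k-x_*\|^2\right).$$
   Context: Problem. Minimise $f:\mathbb R^n\to\mathbb R$ over $\mathcal F=\{x: l\le x\le u\}$, where $l\in(\mathbb R\cup\{-\infty\})^n$, $u\in(\mathbb R\cup\{+\infty\})^n$, $l<u$; $\mathrm{int}(\mathcal F)=\{x:l<x<u\}$. Write $g=\nabla f$, $H=\nabla^2 f$; superscript $i$ denotes the $i$-th component. $\|\cdot\|$ is the Euclidean norm or its induced matrix norm; $B(x,r)$ is the closed ball. Affine scaling. $v^i(x)=x^i-u^i$ if $g^i(x)<0,\ u^i<\infty$; $v^i(x)=x^i-l^i$ if $g^i(x)\ge0,\ l^i>-\infty$; $v^i(x)=-1$ if $g^i(x)<0,\ u^i=\infty$; $v^i(x)=1$ if $g^i(x)\ge0,\ l^i=-\infty$. $D(x)=\mathrm{diag}(|v(x)|^{-1/2})$, so $D^{-1}(x)=\mathrm{diag}(|v^i(x)|^{1/2})$. $J^v(x)$ is the diagonal matrix whose $i$-th entry (the derivative of $|v^i|$ with respect to $x^i$) is $1$ if $g^i(x)\ge0,\ l^i>-\infty$; $-1$ if $g^i(x)<0,\ u^i<\infty$; $0$ otherwise. $\overline g(x)=D^{-1}(x)g(x)$, $\overline C(x)=\mathrm{diag}(g(x))J^v(x)$, $\overline B(x)=D^{-1}(x)H(x)D^{-1}(x)+\overline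 C(x)$. A subscript $k$ means evaluation at $x_k$. Subproblem. $[s_k;t_k]$ is an optimal solution of $\min_{\|[s;t]\|\le1}[s;t]^TF_k[s;t]$ with $F_k=\begin{bmatrix}\overline B_k&\overline g_k\\ \overline g_k^T&-\delta\end{bmatrix}$. Algorithm SOBASIP. Parameters: $\nu\in(0,1/2)$, $\gamma>0$, $\beta\in(0,1)$, $\tau\in(0,1)$, $\Delta>0$, $\delta\ge0$; the initial point lies in $\mathrm{int}(\mathcal F)$. At iteration $k$: compute $[s_k;t_k]$. If $|t_k|>\sqrt{1/(1+\Delta^2)}$ (small value case), set $\overline d_k=s_k/t_k$, $d_k=D_k^{-1}\overline d_k$, $x_{k+1}=x_k+d_k$; in the global version the algorithm then stops, but for the local analysis it does not stop and continues with $\delta=0$. Otherwise set $\overline d_k=s_k/t_k$ if $|t_k|\ge\nu$, and $\overline d_k=\mathrm{sign}(-\overline g_k^Ts_k)\,s_k$ if $|t_k|<\nu$; set $d_k=D_k^{-1}\overline d_k$; let $\alpha_k^{\max}=\min_i\max\{(l^i-x_k^i)/d_k^i,(u^i-x_k^i)/d_k^i\}$, $\alpha_{k,0}=\tau\min\{1,\alpha_k^{\max}\}$, and take $\alpha_k$ to be the first $\alpha_{k,j}=\beta^j\alpha_{k,0}$, $j=0,1,\dots$, with $f(x_k+\alpha_{k,j}d_k)-f(x_k)\le-\frac{\gamma}{6}\alpha_{k,j}^3\|\overline d_k\|^3$; set $x_{k+1}=x_k+\alpha_kd_k$. In the local phase (large $k$), $\delta=0$, $\|\overline d_k\|\le\Delta$,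 and the step is $x_{k+1}=x_k+D_k^{-1}\overline d_k$ with $\overline d_k=s_k/t_k$ (step size $1$, no line search). Assumptions. (A1) There is a bounded closed set $X\subset\mathrm{int}(\mathcal F)$ containing all iterates $x_k$. (A2) $f$ is thrice continuously differentiable on $X$; there is $L_H>0$ with $\|H(x)-H(y)\|\le L_H\|x-y\|$ for all $x,y\in X$; and there is $U_H>0$ with $\|H_k\|\le U_H$ for all $k$. (A3) There are $\gamma_D,\gamma_B>0$ with $\|D_k^{-1}\|\le\gamma_D$ and $\|\overline B_k\|\le\gamma_B$ for all $k$. (A4) The algorithm converges to a strict local optimum $x_*$ satisfying $\overline g(x_* )=0$ and $\overline B(x_* )\succ0$; it is understood that there are $r>0$, $\mu>0$ with $\overline B(x)\succeq\mu I$ for all $x\in B(x_*,r)$. (A5) There is $L_D>0$ with $\|D^{-1}(x)-D^{-1}(y)\|\le L_D\|x-y\|$ for all $x,y\in B(x_*,r)$. *)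

theory Defs
  imports "HOL-Analysis.Analysis" "HOL-Library.Landau_Symbols"
begin

section \<open>Calculus and matrices\<close>

definition grad :: "('a::real_inner \<Rightarrow> real) \<Rightarrow> 'a \<Rightarrow> 'a" where
  "grad f x = (THE D. GDERIV f x :> D)"

definition hessian :: "(real^'n \<Rightarrow> real) \<Rightarrow> real^'n \<Rightarrow> real^'n^'n" where
  "hessian f x = jacobian (grad f) (at x)"

text \<open>Only meaningful for an open set \<open>S\<close>.\<close>

primrec Ck_on_open :: "nat \<Rightarrow> (real^'n \<Rightarrow> real) \<Rightarrow> (real^'n) set \<Rightarrow> bool" where
  "Ck_on_open 0 f S \<longleftrightarrow> continuous_on S f"
| "Ck_on_open (Suc k) f S \<longleftrightarrow>
     f differentiable_on S \<and> (\<forall>i. Ck_on_open k (\<lambda>x. grad f x $ i) S)"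

text \<open>Smoothness on an arbitrary set means smoothness on some open neighbourhood of it, so that
  the derivatives at the points of the set are determined.\<close>

definition Ck_on :: "nat \<Rightarrow> (real^'n \<Rightarrow> real) \<Rightarrow> (real^'n) set \<Rightarrow> bool" where
  "Ck_on k f X \<longleftrightarrow> (\<exists>S. open S \<and> X \<subseteq> S \<and> Ck_on_open k f S)"

definition strict_local_min_on :: "('a::topological_space \<Rightarrow> real) \<Rightarrow> 'a set \<Rightarrow> 'a \<Rightarrow> bool" where
  "strict_local_min_on f S x \<longleftrightarrow> x \<in> S \<and> (\<forall>\<^sub>F y in at x within S. f x < f y)"

text \<open>The norm of the type of matrices is the Frobenius norm; this is the one induced by the
  Euclidean norm.\<close>

definition mnorm :: "real^'n^'m \<Rightarrow> real" where
  "mnorm A = onorm ((*v) A)"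

definition diag :: "real^'n \<Rightarrow> real^'n^'n" where
  "diag w = (\<chi> i j. if i = j then w $ i else 0)"

definition pos_semidef :: "real^'n^'n \<Rightarrow> bool" where
  "pos_semidef A \<longleftrightarrow> transpose A = A \<and> (\<forall>y. 0 \<le> y \<bullet> (A *v y))"

definition pos_def :: "real^'n^'n \<Rightarrow> bool" where
  "pos_def A \<longleftrightarrow> transpose A = A \<and> (\<forall>y. y \<noteq> 0 \<longrightarrow> 0 < y \<bullet> (A *v y))"


section \<open>Bound constraints and affine scaling\<close>

definition box_feasible :: "ereal^'n \<Rightarrow> ereal^'n \<Rightarrow> (real^'n) set" where
  "box_feasible l u = {x. \<forall>i. l $ i \<le> ereal (x $ i) \<and> ereal (x $ i) \<le> u $ i}"

definition box_interior :: "ereal^'n \<Rightarrow> ereal^'n \<Rightarrow> (real^'n) set" where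
  "box_interior l u = {x. \<forall>i. l $ i < ereal (x $ i) \<and> ereal (x $ i) < u $ i}"

definition scal_v :: "(real^'n \<Rightarrow> real) \<Rightarrow> ereal^'n \<Rightarrow> ereal^'n \<Rightarrow> real^'n \<Rightarrow> real^'n" where
  "scal_v f l u x = (\<chi> i.
     if grad f x $ i < 0
     then (if u $ i < \<infinity> then x $ i - real_of_ereal (u $ i) else -1)
     else (if l $ i > -\<infinity> then x $ i - real_of_ereal (l $ i) else 1))"

text \<open>The inverse \<open>D\<^sup>-\<^sup>1(x)\<close> of the scaling matrix \<open>D(x) = diag(|v(x)|\<^sup>-\<^sup>1\<^sup>/\<^sup>2)\<close>.\<close>

definition scal_Dinv :: "(real^'n \<Rightarrow> real) \<Rightarrow> ereal^'n \<Rightarrow> ereal^'n \<Rightarrow> real^'n \<Rightarrow> real^'n^'n" where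
  "scal_Dinv f l u x = diag (\<chi> i. sqrt \<bar>scal_v f l u x $ i\<bar>)"

definition scal_Jv :: "(real^'n \<Rightarrow> real) \<Rightarrow> ereal^'n \<Rightarrow> ereal^'n \<Rightarrow> real^'n \<Rightarrow> real^'n^'n" where
  "scal_Jv f l u x = diag (\<chi> i.
     if grad f x $ i \<ge> 0 \<and> l $ i > -\<infinity> then 1
     else if grad f x $ i < 0 \<and> u $ i < \<infinity> then -1
     else 0)"

definition scal_g :: "(real^'n \<Rightarrow> real) \<Rightarrow> ereal^'n \<Rightarrow> ereal^'n \<Rightarrow> real^'n \<Rightarrow> real^'n" where
  "scal_g f l u x = scal_Dinv f l u x *v grad f x"

definition scal_C :: "(real^'n \<Rightarrow> real) \<Rightarrow> ereal^'n \<Rightarrow> ereal^'n \<Rightarrow> real^'n \<Rightarrow> real^'n^'n" where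
  "scal_C f l u x = diag (grad f x) ** scal_Jv f l u x"

definition scal_B :: "(real^'n \<Rightarrow> real) \<Rightarrow> ereal^'n \<Rightarrow> ereal^'n \<Rightarrow> real^'n \<Rightarrow> real^'n^'n" where
  "scal_B f l u x =
     scal_Dinv f l u x ** hessian f x ** scal_Dinv f l u x + scal_C f l u x"


section \<open>The homogenised subproblem\<close>

text \<open>Vectors \<open>[s;t]\<close> of dimension \<open>n + 1\<close> are indexed by \<open>'n + unit\<close>.\<close>

definition vec_append :: "real^'n \<Rightarrow> real \<Rightarrow> real^('n + unit)" where
  "vec_append s t = (\<chi> a. case a of Inl i \<Rightarrow> s $ i | Inr _ \<Rightarrow> t)"

definition hom_matrix :: "real^'n^'n \<Rightarrow> real^'n \<Rightarrow> real \<Rightarrow> real^('n + unit)^('n + unit)" where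
  "hom_matrix B g \<delta> = (\<chi> a b.
     case a of
       Inl i \<Rightarrow> (case b of Inl j \<Rightarrow> B $ i $ j | Inr _ \<Rightarrow> g $ i)
     | Inr _ \<Rightarrow> (case b of Inl j \<Rightarrow> g $ j | Inr _ \<Rightarrow> - \<delta>))"

definition subproblem_solution ::
  "(real^'n \<Rightarrow> real) \<Rightarrow> ereal^'n \<Rightarrow> ereal^'n \<Rightarrow> real \<Rightarrow> real^'n \<Rightarrow> real^'n \<Rightarrow> real \<Rightarrow> bool" where
  "subproblem_solution f l u \<delta> x s t \<longleftrightarrow>
     is_arg_min (\<lambda>z. z \<bullet> (hom_matrix (scal_B f l u x) (scal_g f l u x) \<delta> *v z))
       (\<lambda>z. norm z \<le> 1) (vec_append s t)"


section \<open>The algorithm\<close>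

definition small_value :: "real \<Rightarrow> real \<Rightarrow> bool" where
  "small_value \<Delta> t \<longleftrightarrow> \<bar>t\<bar> > sqrt (1 / (1 + \<Delta>\<^sup>2))"

text \<open>Division in \<open>ereal\<close> satisfies \<open>a / 0 = \<infinity>\<close> for \<open>a > 0\<close> and \<open>a / 0 = -\<infinity>\<close> for \<open>a < 0\<close>, so for
  \<open>x\<close> in the interior of the box a vanishing component of \<open>d\<close> imposes no restriction.\<close>

definition alpha_max :: "ereal^'n \<Rightarrow> ereal^'n \<Rightarrow> real^'n \<Rightarrow> real^'n \<Rightarrow> ereal" where
  "alpha_max l u x d =
     (MIN i. max ((l $ i - ereal (x $ i)) / ereal (d $ i))
                 ((u $ i - ereal (x $ i)) / ereal (d $ i)))"

definition alpha_trial ::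
  "ereal^'n \<Rightarrow> ereal^'n \<Rightarrow> real \<Rightarrow> real \<Rightarrow> real^'n \<Rightarrow> real^'n \<Rightarrow> nat \<Rightarrow> real" where
  "alpha_trial l u \<beta> \<tau> x d j = \<beta> ^ j * (\<tau> * real_of_ereal (min 1 (alpha_max l u x d)))"

definition sufficient_decrease ::
  "(real^'n \<Rightarrow> real) \<Rightarrow> real \<Rightarrow> real^'n \<Rightarrow> real^'n \<Rightarrow> real^'n \<Rightarrow> real \<Rightarrow> bool" where
  "sufficient_decrease f \<gamma> x dbar d \<alpha> \<longleftrightarrow>
     f (x + \<alpha> *\<^sub>R d) - f x \<le> - (\<gamma> / 6) * \<alpha> ^ 3 * norm dbar ^ 3"

definition sobasip_dbar ::
  "(real^'n \<Rightarrow> real) \<Rightarrow> ereal^'n \<Rightarrow> ereal^'n \<Rightarrow> real \<Rightarrow> real \<Rightarrow> real^'n \<Rightarrow> real^'n \<Rightarrow> real \<Rightarrow> real^'n"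
where
  "sobasip_dbar f l u \<nu> \<Delta> x s t =
     (if small_value \<Delta> t \<or> \<bar>t\<bar> \<ge> \<nu> then s /\<^sub>R t
      else sgn (- (scal_g f l u x \<bullet> s)) *\<^sub>R s)"

text \<open>The version of the algorithm used for local analysis: the small value case does not stop.\<close>

definition sobasip_step ::
  "(real^'n \<Rightarrow> real) \<Rightarrow> ereal^'n \<Rightarrow> ereal^'n \<Rightarrow> real \<Rightarrow> real \<Rightarrow> real \<Rightarrow> real \<Rightarrow> real \<Rightarrow>
    real^'n \<Rightarrow> real^'n \<Rightarrow> real \<Rightarrow> real^'n \<Rightarrow> bool" where
  "sobasip_step f l u \<nu> \<gamma> \<beta> \<tau> \<Delta> x s t x' \<longleftrightarrow>
     (let dbar = sobasip_dbar f l u \<nu> \<Delta> x s t;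
          d = scal_Dinv f l u x *v dbar;
          \<alpha> = alpha_trial l u \<beta> \<tau> x d
      in if small_value \<Delta> t then x' = x + d
         else (\<exists>j. sufficient_decrease f \<gamma> x dbar d (\<alpha> j) \<and>
                   (\<forall>i<j. \<not> sufficient_decrease f \<gamma> x dbar d (\<alpha> i)) \<and>
                   x' = x + \<alpha> j *\<^sub>R d))"

text \<open>The perturbation used at iteration \<open>k\<close>: the given \<open>\<delta>\<close> up to and including the first small
  value case, and \<open>0\<close> from then on.\<close>

primrec sobasip_delta :: "real \<Rightarrow> real \<Rightarrow> (nat \<Rightarrow> real) \<Rightarrow> nat \<Rightarrow> real" where
  "sobasip_delta \<Delta> \<delta> t 0 = \<delta>"
| "sobasip_delta \<Delta> \<delta> t (Suc k) =
     (if small_value \<Delta> (t k) then 0 else sobasip_delta \<Delta> \<delta> t k)"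

definition sobasip_run ::
  "(real^'n \<Rightarrow> real) \<Rightarrow> ereal^'n \<Rightarrow> ereal^'n \<Rightarrow> real \<Rightarrow> real \<Rightarrow> real \<Rightarrow> real \<Rightarrow> real \<Rightarrow> real \<Rightarrow>
    (nat \<Rightarrow> real^'n) \<Rightarrow> (nat \<Rightarrow> real^'n) \<Rightarrow> (nat \<Rightarrow> real) \<Rightarrow> bool" where
  "sobasip_run f l u \<nu> \<gamma> \<beta> \<tau> \<Delta> \<delta> x s t \<longleftrightarrow>
     x 0 \<in> box_interior l u \<and>
     (\<forall>k. subproblem_solution f l u (sobasip_delta \<Delta> \<delta> t k) (x k) (s k) (t k) \<and>
          sobasip_step f l u \<nu> \<gamma> \<beta> \<tau> \<Delta> (x k) (s k) (t k) (x (Suc k)))"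

end

theory Submission
  imports Defs
begin

text \<open>Since \<open>X\<close> is closed and contained in the interior of the box, the limit point is interior. There
  \<open>D\<^sup>-\<^sup>1\<close> is invertible, so the unscaled gradient vanishes at the limit. A minimiser \<open>[s;t]\<close> of the
  subproblem is an eigenvector of \<open>F\<close> for an eigenvalue \<open>m \<le> 0\<close>; coercivity of the scaled matrix \<open>B\<close>
  gives \<open>\<parallel>s\<parallel> \<le> |t| \<parallel>g\<parallel> / \<mu>\<close> for the scaled gradient \<open>g\<close>. As \<open>g\<close> tends to 0, either the small
  value case occurs or \<open>s = 0\<close>, \<open>g = 0\<close> and \<open>\<delta> = 0\<close>, so that eventually \<open>\<delta> = 0\<close> and every step is a
  perturbed Newton step \<open>(B - m) d = -g\<close> with \<open>m = g \<bullet> d\<close> of second order. The part \<open>C\<close> of \<open>B\<close> is of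
  first order, so both \<open>C d\<close> and \<open>m d\<close> are at least of second order. Writing the error as \<open>e = D\<^sup>-\<^sup>1 w\<close>,
  the vector \<open>(B - C)(d + w)\<close> consists of these terms and a Taylor remainder of the gradient; the new
  error is \<open>D\<^sup>-\<^sup>1(d + w)\<close>.\<close>

section \<open>Taylor expansion of the gradient\<close>

lemma differentiable_vec:
  fixes F :: "'a::real_normed_vector \<Rightarrow> real^'n"
  assumes "\<And>i. (\<lambda>x. F x $ i) differentiable (at a)"
  shows "F differentiable (at a)"
proof -
  have "\<forall>i. \<exists>F'. ((\<lambda>x. F x $ i) has_derivative F') (at a)"
    using assms by (simp add: differentiable_def)
  then obtain F' where F': "\<And>i. ((\<lambda>x. F x $ i) has_derivative F' i) (at a)"
    by metis
  have "(F has_derivative (\<lambda>h. \<chi> i. F' i h)) (at a)"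
    by (subst has_derivative_componentwise_within) (auto simp: Basis_vec_def inner_axis F')
  then show ?thesis
    by (auto simp: differentiable_def)
qed

text \<open>\<open>grad\<close> is a definite description, so existence and uniqueness are both
  needed: the derivative is linear, hence the inner product with \<open>adjoint f' 1\<close>, and
  derivatives are unique.\<close>

lemma GDERIV_grad:
  fixes f :: "real^'n \<Rightarrow> real"
  assumes "f differentiable (at a)"
  shows "GDERIV f a :> grad f a"
proof -
  obtain f' where f': "(f has_derivative f') (at a)"
    using assms by (auto simp: differentiable_def)
  have "linear f'"
    using f' has_derivative_linear by blast
  then have "f' = (\<lambda>h. h \<bullet> adjoint f' 1)"
    by (simp add: adjoint_works fun_eq_iff)
  then have G: "GDERIV f a :> adjoint f' 1"
    using f' by (simp add: gderiv_def)
  have "D = adjoint f' 1" if "GDERIV f a :> D" for D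
  proof -
    have "(\<lambda>h. h \<bullet> D) = (\<lambda>h. h \<bullet> adjoint f' 1)"
      using G that has_derivative_unique unfolding gderiv_def by blast
    then have "\<forall>h. h \<bullet> D = h \<bullet> adjoint f' 1"
      by meson
    then show ?thesis
      by (simp add: vector_eq_ldot)
  qed
  with G have "grad f a = adjoint f' 1"
    unfolding grad_def by (intro the_equality)
  with G show ?thesis
    by simp
qed

lemma hessian_has_derivative:
  fixes f :: "real^'n \<Rightarrow> real"
  assumes "\<And>i. (\<lambda>x. grad f x $ i) differentiable (at a)"
  shows "(grad f has_derivative (\<lambda>h. hessian f a *v h)) (at a)"
  unfolding hessian_def using differentiable_vec[OF assms] jacobian_works by blast

text \<open>Both sides represent the derivative of one gradient component. The right-hand form is
  the one whose differentiability \<open>Ck_on_open\<close> provides, so this carries third-order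
  smoothness over to the entries of the Hessian.\<close>

lemma hessian_nth:
  fixes f :: "real^'n \<Rightarrow> real"
  assumes "\<And>i. (\<lambda>x. grad f x $ i) differentiable (at a)"
  shows "hessian f a $ i $ j = grad (\<lambda>x. grad f x $ i) a $ j"
proof -
  have "((\<lambda>x. grad f x $ i) has_derivative (\<lambda>h. (hessian f a *v h) $ i)) (at a)"
    by (rule bounded_linear.has_derivative[OF bounded_linear_vec_nth hessian_has_derivative[OF assms]])
  moreover have "((\<lambda>x. grad f x $ i) has_derivative (\<lambda>h. h \<bullet> grad (\<lambda>x. grad f x $ i) a)) (at a)"
    using GDERIV_grad[OF assms] by (simp add: gderiv_def)
  ultimately have "(\<lambda>h. (hessian f a *v h) $ i) = (\<lambda>h. h \<bullet> grad (\<lambda>x. grad f x $ i) a)"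
    by (rule has_derivative_unique)
  then have "(hessian f a *v axis j 1) $ i = axis j 1 \<bullet> grad (\<lambda>x. grad f x $ i) a"
    by meson
  then show ?thesis
    by (simp add: matrix_vector_mult_basis column_def inner_axis')
qed

text \<open>With tolerance 1 in the definition of the derivative, the increment is at most
  \<open>1 + onorm h'\<close> times the distance. Only pairs containing the fixed point
  \<open>a\<close> are compared.\<close>

lemma differentiable_imp_pointwise_Lipschitz:
  fixes h :: "'a::real_normed_vector \<Rightarrow> 'b::real_normed_vector"
  assumes "h differentiable (at a)"
  obtains L where "0 \<le> L" "\<forall>\<^sub>F y in nhds a. norm (h y - h a) \<le> L * norm (y - a)"
proof -
  obtain h' where h': "(h has_derivative h') (at a)"
    using assms by (auto simp: differentiable_def)
  then have bl: "bounded_linear h'"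
    by (rule has_derivative_bounded_linear)
  from h' obtain d where d: "d > 0"
    "\<And>y. norm (y - a) < d \<Longrightarrow> norm (h y - h a - h' (y - a)) \<le> 1 * norm (y - a)"
    unfolding has_derivative_at_alt by (meson zero_less_one)
  have "norm (h y - h a) \<le> (1 + onorm h') * norm (y - a)" if "dist y a < d" for y
  proof -
    have "norm (h y - h a) \<le> norm (h y - h a - h' (y - a)) + norm (h' (y - a))"
      using norm_triangle_ineq[of "h y - h a - h' (y - a)" "h' (y - a)"] by simp
    also have "\<dots> \<le> norm (y - a) + onorm h' * norm (y - a)"
      using d(2)[of y] that onorm[OF bl, of "y - a"] by (simp add: dist_norm)
    finally show ?thesis
      by (simp add: algebra_simps)
  qed
  then have "\<forall>\<^sub>F y in nhds a. norm (h y - h a) \<le> (1 + onorm h') * norm (y - a)"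
    using d(1) by (auto simp: eventually_nhds_metric)
  with onorm_pos_le[OF bl] show ?thesis
    by (intro that[of "1 + onorm h'"]) auto
qed

lemma norm_mult_le_mnorm:
  fixes A :: "real^'n^'m"
  shows "norm (A *v y) \<le> mnorm A * norm y"
  unfolding mnorm_def by (rule onorm) simp

text \<open>The Hessian stands at \<open>y\<close> rather than at \<open>a\<close>, because the
  Newton equation uses the Hessian at the current iterate. Its entries are differentiable at
  \<open>a\<close>, so it varies at most linearly in the distance from \<open>a\<close>, and the
  mean value inequality turns this into a quadratic remainder. The ball used lies in the open
  neighbourhood \<open>S\<close> and may leave \<open>X\<close>.\<close>

lemma grad_taylor:
  fixes f :: "real^'n \<Rightarrow> real"
  assumes "Ck_on 3 f X" "a \<in> X"
  obtains K where "0 \<le> K"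
    "\<forall>\<^sub>F y in nhds a. norm (grad f y - grad f a - hessian f y *v (y - a)) \<le> K * (norm (y - a))\<^sup>2"
proof -
  obtain S where S: "open S" "X \<subseteq> S" "Ck_on_open 3 f S"
    using assms(1) by (auto simp: Ck_on_def)
  have aS: "a \<in> S"
    using S assms(2) by auto
  have d1: "(\<lambda>x. grad f x $ i) differentiable (at y)" if "y \<in> S" for y i
    using S that by (auto simp: numeral_3_eq_3 differentiable_on_eq_differentiable_at)
  have d2: "(\<lambda>x. grad (\<lambda>x. grad f x $ i) x $ j) differentiable (at a)" for i j
    using S aS by (auto simp: numeral_3_eq_3 differentiable_on_eq_differentiable_at)
  have "\<exists>L. 0 \<le> L \<and> (\<forall>\<^sub>F y in nhds a. \<bar>hessian f y $ i $ j - hessian f a $ i $ j\<bar> \<le> L * norm (y - a))"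
    for i j
  proof -
    obtain L where "0 \<le> L" and L: "\<forall>\<^sub>F y in nhds a. norm (grad (\<lambda>x. grad f x $ i) y $ j
        - grad (\<lambda>x. grad f x $ i) a $ j) \<le> L * norm (y - a)"
      using differentiable_imp_pointwise_Lipschitz[OF d2] .
    have "\<forall>\<^sub>F y in nhds a. y \<in> S"
      using S aS by (simp add: eventually_nhds_in_open)
    with L have "\<forall>\<^sub>F y in nhds a. \<bar>hessian f y $ i $ j - hessian f a $ i $ j\<bar> \<le> L * norm (y - a)"
      by eventually_elim (simp add: hessian_nth[OF d1] aS)
    with \<open>0 \<le> L\<close> show ?thesis
      by blast
  qed
  then have "\<forall>i j. \<exists>L. 0 \<le> L \<and>
      (\<forall>\<^sub>F y in nhds a. \<bar>hessian f y $ i $ j - hessian f a $ i $ j\<bar> \<le> L * norm (y - a))"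
    by blast
  then obtain L where L0: "\<And>i j. 0 \<le> L i j" and
    L: "\<And>i j. \<forall>\<^sub>F y in nhds a. \<bar>hessian f y $ i $ j - hessian f a $ i $ j\<bar> \<le> L i j * norm (y - a)"
    unfolding choice_iff by blast
  \<comment> \<open>The operator norm is at most the sum of the absolute values of the entries, so
    the entrywise constants add up.\<close>
  define K where "K = (\<Sum>i\<in>UNIV. \<Sum>j\<in>UNIV. L i j)"
  have K0: "0 \<le> K"
    unfolding K_def by (intro sum_nonneg L0)
  have "\<forall>\<^sub>F y in nhds a. y \<in> S \<and> (\<forall>i j. \<bar>hessian f y $ i $ j - hessian f a $ i $ j\<bar> \<le> L i j * norm (y - a))"
    using S aS L by (simp add: eventually_conj_iff eventually_nhds_in_open eventually_all_finite)
  then obtain d where d: "d > 0" "\<And>y. dist y a < d \<Longrightarrow> y \<in> S"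
    "\<And>y i j. dist y a < d \<Longrightarrow> \<bar>hessian f y $ i $ j - hessian f a $ i $ j\<bar> \<le> L i j * norm (y - a)"
    unfolding eventually_nhds_metric by blast
  have H: "mnorm (hessian f y - hessian f a) \<le> K * norm (y - a)" if "dist y a < d" for y
  proof -
    have "mnorm (hessian f y - hessian f a)
        \<le> (\<Sum>i\<in>UNIV. \<Sum>j\<in>UNIV. \<bar>(hessian f y - hessian f a) $ i $ j\<bar>)"
      unfolding mnorm_def by (rule onorm_le_matrix_component_sum)
    also have "\<dots> \<le> (\<Sum>i\<in>UNIV. \<Sum>j\<in>UNIV. L i j * norm (y - a))"
      using d(3)[OF that] by (intro sum_mono) simp
    finally show ?thesis
      by (simp add: K_def sum_distrib_right)
  qed
  have "norm (grad f y - grad f a - hessian f y *v (y - a)) \<le> 2 * K * (norm (y - a))\<^sup>2"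
    if y: "dist y a < d" for y
  proof -
    let ?R = "cball a (norm (y - a))"
    \<comment> \<open>With the Hessian frozen at \<open>y\<close>, the derivative at
      \<open>z\<close> is the difference of the Hessians at \<open>z\<close> and \<open>y\<close>.
      The Lipschitz bound is available only against \<open>a\<close>, so the comparison passes
      through \<open>a\<close>, whence the factor 2.\<close>
    let ?\<psi> = "\<lambda>z. grad f z - hessian f y *v z"
    have R: "dist z a < d \<and> norm (z - a) \<le> norm (y - a)" if "z \<in> ?R" for z
      using y that by (simp add: dist_norm norm_minus_commute[of a])
    have "norm (?\<psi> y - ?\<psi> a) \<le> 2 * K * norm (y - a) * norm (y - a)"
    proof (rule differentiable_bound[of ?R ?\<psi> "\<lambda>z h. hessian f z *v h - hessian f y *v h"])
      fix z assume z: "z \<in> ?R"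
      have "(grad f has_derivative (\<lambda>h. hessian f z *v h)) (at z within ?R)"
        using R[OF z] by (blast intro: has_derivative_at_withinI hessian_has_derivative[OF d1] d(2))
      then show "(?\<psi> has_derivative (\<lambda>h. hessian f z *v h - hessian f y *v h)) (at z within ?R)"
        by (rule has_derivative_diff[OF _ bounded_linear_imp_has_derivative[OF matrix_vector_mul_bounded_linear]])
      show "onorm (\<lambda>h. hessian f z *v h - hessian f y *v h) \<le> 2 * K * norm (y - a)"
      proof (rule onorm_le)
        fix h
        have "norm (hessian f z *v h - hessian f y *v h)
            = norm ((hessian f z - hessian f a) *v h - (hessian f y - hessian f a) *v h)"
          by (simp add: matrix_vector_mult_diff_rdistrib)
        also have "\<dots> \<le> norm ((hessian f z - hessian f a) *v h) + norm ((hessian f y - hessian f a) *v h)"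
          by (rule norm_triangle_ineq4)
        also have "\<dots> \<le> mnorm (hessian f z - hessian f a) * norm h + mnorm (hessian f y - hessian f a) * norm h"
          by (intro add_mono norm_mult_le_mnorm)
        also have "\<dots> \<le> (K * norm (y - a)) * norm h + (K * norm (y - a)) * norm h"
        proof -
          have "mnorm (hessian f z - hessian f a) \<le> K * norm (y - a)"
            using H[of z] R[OF z] mult_left_mono[OF _ K0, of "norm (z - a)" "norm (y - a)"] by linarith
          then show ?thesis
            using H[OF y] by (intro add_mono mult_right_mono) auto
        qed
        finally show "norm (hessian f z *v h - hessian f y *v h) \<le> 2 * K * norm (y - a) * norm h"
          by (simp add: mult_ac)
      qed
    qed (auto simp: dist_norm norm_minus_commute)
    then show ?thesis
      by (simp add: matrix_vector_mult_diff_distrib algebra_simps power2_eq_square)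
  qed
  then show ?thesis
    using K0 d(1) by (intro that[of "2 * K"]) (auto simp: eventually_nhds_metric)
qed


section \<open>The homogenised subproblem\<close>

lemma sum_UNIV_plus_unit:
  fixes h :: "'n::finite + unit \<Rightarrow> 'a::comm_monoid_add"
  shows "(\<Sum>a\<in>UNIV. h a) = (\<Sum>i\<in>UNIV. h (Inl i)) + h (Inr ())"
proof -
  have "(\<Sum>a\<in>UNIV. h a) = (\<Sum>a\<in>UNIV <+> UNIV. h a)"
    by simp
  also have "\<dots> = (\<Sum>i\<in>UNIV. h (Inl i)) + (\<Sum>i\<in>UNIV. h (Inr i))"
    by (subst sum.Plus) auto
  finally show ?thesis
    by (simp add: UNIV_unit)
qed

lemma inner_vec_append: "vec_append s t \<bullet> vec_append s' t' = s \<bullet> s' + t * t'"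
  by (simp add: inner_vec_def sum_UNIV_plus_unit vec_append_def)

lemma vec_append_eq_iff [simp]: "vec_append s t = vec_append s' t' \<longleftrightarrow> s = s' \<and> t = t'"
  by (auto simp: vec_append_def vec_eq_iff split: sum.splits)

lemma scaleR_vec_append: "c *\<^sub>R vec_append s t = vec_append (c *\<^sub>R s) (c * t)"
  by (auto simp: vec_append_def vec_eq_iff split: sum.splits)

lemma hom_matrix_mult:
  "hom_matrix B g \<delta> *v vec_append s t = vec_append (B *v s + t *\<^sub>R g) (g \<bullet> s - \<delta> * t)"
  by (auto simp: vec_eq_iff matrix_vector_mult_def sum_UNIV_plus_unit hom_matrix_def vec_append_def
      inner_vec_def split: sum.splits)

lemma transpose_hom_matrix:
  assumes "transpose B = B"
  shows "transpose (hom_matrix B g \<delta>) = hom_matrix B g \<delta>"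
proof -
  have B: "B $ i $ j = B $ j $ i" for i j
    using arg_cong[OF assms, of "\<lambda>A. A $ j $ i"] by (simp add: transpose_def)
  have "hom_matrix B g \<delta> $ b $ a = hom_matrix B g \<delta> $ a $ b" for a b
    by (cases a; cases b) (auto simp: hom_matrix_def intro: B)
  then show ?thesis
    by (simp add: vec_eq_iff transpose_def)
qed

lemma symmetric_inner:
  fixes A :: "real^'n^'n"
  assumes "transpose A = A"
  shows "y \<bullet> (A *v z) = z \<bullet> (A *v y)"
  using dot_lmul_matrix[of y A z] transpose_matrix_vector[of A y] by (simp add: assms inner_commute)

text \<open>The form of \<open>A - m I\<close> is nonnegative and vanishes at \<open>z\<close>. If
  the residual \<open>w\<close> were nonzero, moving from \<open>z\<close> a little along
  \<open>-w\<close> would make the form negative.\<close>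

lemma quadratic_form_minimiser_eigenvector:
  fixes A :: "real^'n^'n"
  assumes sym: "transpose A = A"
    and lower: "\<And>y. m * (y \<bullet> y) \<le> y \<bullet> (A *v y)"
    and attained: "z \<bullet> (A *v z) = m * (z \<bullet> z)"
  shows "A *v z = m *\<^sub>R z"
proof (rule ccontr)
  define w where "w = A *v z - m *\<^sub>R z"
  assume "A *v z \<noteq> m *\<^sub>R z"
  then have w: "0 < w \<bullet> w"
    by (simp add: w_def)
  define c where "c = w \<bullet> (A *v w) - m * (w \<bullet> w)"
  have c0: "0 \<le> c"
    using lower[of w] by (simp add: c_def)
  have cross: "w \<bullet> (A *v z) - m * (w \<bullet> z) = w \<bullet> w"
    by (simp add: w_def algebra_simps inner_commute)
  have ineq: "0 \<le> 2 * e * (w \<bullet> w) + e\<^sup>2 * c" for e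
  proof -
    let ?y = "z + e *\<^sub>R w"
    have "?y \<bullet> (A *v ?y) - m * (?y \<bullet> ?y)
        = 2 * e * (w \<bullet> (A *v z) - m * (w \<bullet> z)) + e\<^sup>2 * c"
      using attained symmetric_inner[OF sym, of z w]
      by (simp add: c_def matrix_vector_right_distrib matrix_vector_mult_scaleR algebra_simps
          inner_commute power2_eq_square)
    then show ?thesis
      using lower[of ?y] cross by simp
  qed
  \<comment> \<open>This step makes the linear term dominate the quadratic one; \<open>c + 1\<close>
    keeps the denominator positive when \<open>c\<close> is 0.\<close>
  define e where "e = - (w \<bullet> w) / (c + 1)"
  have e: "e < 0" "e * (c + 1) = - (w \<bullet> w)"
    using w c0 by (auto simp: e_def field_simps)
  have "2 * e * (w \<bullet> w) + e\<^sup>2 * c \<le> 2 * e * (w \<bullet> w) + e * (e * (c + 1))"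
    by (simp add: power2_eq_square algebra_simps)
  also have "\<dots> = e * (w \<bullet> w)"
    by (simp add: e(2))
  also have "\<dots> < 0"
    using e(1) w by (rule mult_neg_pos)
  finally show False
    using ineq[of e] by simp
qed

text \<open>Here \<open>m\<close> is the minimal value on the ball. It is not positive because 0 is
  feasible, and by scaling it bounds the Rayleigh quotient from below. If \<open>m < 0\<close>, an
  interior minimiser could be improved by stretching it to the sphere; if \<open>m = 0\<close>, the
  minimiser may be any kernel vector, including 0, so nothing is claimed about its norm.\<close>

lemma unit_ball_minimiser:
  fixes A :: "real^'n^'n"
  assumes sym: "transpose A = A"
    and min: "is_arg_min (\<lambda>z. z \<bullet> (A *v z)) (\<lambda>z. norm z \<le> 1) z"
  obtains m where "m \<le> 0" "\<And>y. m * (y \<bullet> y) \<le> y \<bullet> (A *v y)" "A *v z = m *\<^sub>R z"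
    "m < 0 \<Longrightarrow> norm z = 1"
proof -
  define m where "m = z \<bullet> (A *v z)"
  have z: "norm z \<le> 1" and m_le: "\<And>y. norm y \<le> 1 \<Longrightarrow> m \<le> y \<bullet> (A *v y)"
    using min by (auto simp: is_arg_min_linorder m_def)
  have m0: "m \<le> 0"
    using m_le[of 0] by simp
  have lower: "m * (y \<bullet> y) \<le> y \<bullet> (A *v y)" for y
  proof (cases "y = 0")
    case False
    let ?y = "(1 / norm y) *\<^sub>R y"
    have "m \<le> ?y \<bullet> (A *v ?y)"
      using False by (intro m_le) simp
    also have "\<dots> = (y \<bullet> (A *v y)) / (norm y)\<^sup>2"
      by (simp add: matrix_vector_mult_scaleR power2_eq_square)
    finally show ?thesis
      using False by (simp add: field_simps power2_norm_eq_inner)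
  qed simp
  have norm1: "norm z = 1" if "m < 0"
  proof (rule ccontr)
    assume "norm z \<noteq> 1"
    with z have "z \<bullet> z < 1"
      by (simp add: dot_square_norm abs_square_less_1)
    with that have "m * 1 < m * (z \<bullet> z)"
      by (intro mult_strict_left_mono_neg)
    then show False
      using lower[of z] by (simp add: m_def)
  qed
  have "z \<bullet> (A *v z) = m * (z \<bullet> z)"
    using m0 norm1 by (cases "m < 0") (auto simp: m_def[symmetric] dot_square_norm)
  with sym lower have "A *v z = m *\<^sub>R z"
    by (rule quadratic_form_minimiser_eigenvector)
  with m0 lower norm1 that show ?thesis
    by blast
qed

text \<open>The split is on the sign of the eigenvalue \<open>m\<close>. If \<open>m < 0\<close>,
  the minimiser has norm 1 and the bound on \<open>s\<close> forces a large \<open>t\<close>, so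
  division by \<open>t\<close> yields a Newton equation shifted by \<open>m\<close>. If
  \<open>m = 0\<close>, the whole matrix is positive semidefinite, which with a nonpositive corner
  entry is possible only when that entry and \<open>g\<close> vanish.\<close>

lemma hom_subproblem_cases:
  fixes B :: "real^'n^'n"
  assumes min: "is_arg_min (\<lambda>z. z \<bullet> (hom_matrix B g \<delta> *v z)) (\<lambda>z. norm z \<le> 1) (vec_append s t)"
    and sym: "transpose B = B"
    and coercive: "\<And>y. \<mu> * (y \<bullet> y) \<le> y \<bullet> (B *v y)"
    and \<mu>: "0 < \<mu>" and \<delta>: "0 \<le> \<delta>" and \<Delta>: "0 < \<Delta>" and g_small: "norm g < \<Delta> * \<mu>"
  shows "s = 0 \<and> g = 0 \<and> \<delta> = 0 \<or>
    small_value \<Delta> t \<and> norm (s /\<^sub>R t) \<le> norm g / \<mu> \<and>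
    B *v (s /\<^sub>R t) + g = (g \<bullet> (s /\<^sub>R t) - \<delta>) *\<^sub>R (s /\<^sub>R t)"
proof -
  let ?F = "hom_matrix B g \<delta>"
  obtain m where m0: "m \<le> 0" and lower: "\<And>y. m * (y \<bullet> y) \<le> y \<bullet> (?F *v y)"
    and eig: "?F *v vec_append s t = m *\<^sub>R vec_append s t"
    and norm1: "m < 0 \<Longrightarrow> norm (vec_append s t) = 1"
    using unit_ball_minimiser[OF transpose_hom_matrix[OF sym] min] by metis
  have eig1: "B *v s + t *\<^sub>R g = m *\<^sub>R s" and eig2: "g \<bullet> s - \<delta> * t = m * t"
    using eig by (auto simp: hom_matrix_mult scaleR_vec_append)
  \<comment> \<open>The first block row of the eigenvector equation is tested with \<open>s\<close>;
    the term with \<open>m\<close> has a favourable sign and is dropped.\<close>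
  have s_le: "norm s \<le> \<bar>t\<bar> * (norm g / \<mu>)"
  proof (cases "s = 0")
    case False
    have "\<mu> * (s \<bullet> s) \<le> s \<bullet> (B *v s)"
      by (rule coercive)
    also have "\<dots> = m * (s \<bullet> s) - t * (s \<bullet> g)"
      using arg_cong[OF eig1, of "\<lambda>y. s \<bullet> y"] by (simp add: inner_right_distrib)
    also have "\<dots> \<le> \<bar>t * (s \<bullet> g)\<bar>"
      using mult_nonpos_nonneg[OF m0, of "s \<bullet> s"] by (smt (verit) inner_ge_zero)
    also have "\<dots> \<le> \<bar>t\<bar> * (norm s * norm g)"
      unfolding abs_mult by (intro mult_left_mono Cauchy_Schwarz_ineq2) auto
    finally have "norm s * (\<mu> * norm s) \<le> norm s * (\<bar>t\<bar> * norm g)"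
      by (simp add: dot_square_norm power2_eq_square mult_ac)
    then have "\<mu> * norm s \<le> \<bar>t\<bar> * norm g"
      using False by simp
    then show ?thesis
      using \<mu> by (simp add: field_simps)
  qed (use \<mu> in simp)
  show ?thesis
  proof (cases "m < 0")
    case True
    have unit: "(norm s)\<^sup>2 + t\<^sup>2 = 1"
      using norm1[OF True] dot_square_norm[of "vec_append s t"]
      by (simp add: inner_vec_append power2_norm_eq_inner power2_eq_square[of t])
    \<comment> \<open>If \<open>t\<close> were 0, \<open>s_le\<close> would give
      \<open>s = 0\<close>, contradicting norm 1.\<close>
    have t0: "t \<noteq> 0"
      using s_le unit by auto
    have "norm g / \<mu> < \<Delta>"
      using g_small \<mu> by (simp add: field_simps)
    then have "norm s < \<bar>t\<bar> * \<Delta>"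
      using s_le t0 by (smt (verit) mult_less_cancel_left_pos)
    then have "(norm s)\<^sup>2 < (\<bar>t\<bar> * \<Delta>)\<^sup>2"
      by (intro power_strict_mono) auto
    then have "1 < t\<^sup>2 * (1 + \<Delta>\<^sup>2)"
      using unit by (simp add: algebra_simps power_mult_distrib)
    moreover have "0 < 1 + \<Delta>\<^sup>2"
      by (simp add: add_pos_nonneg)
    ultimately have "1 / (1 + \<Delta>\<^sup>2) < t\<^sup>2"
      by (simp add: field_simps)
    then have "small_value \<Delta> t"
      unfolding small_value_def using real_sqrt_less_mono by fastforce
    moreover have "norm (s /\<^sub>R t) \<le> norm g / \<mu>"
      using s_le t0 by (simp add: field_simps)
    moreover have "m = g \<bullet> (s /\<^sub>R t) - \<delta>"
      using eig2 t0 by (simp add: field_simps)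
    moreover have "B *v (s /\<^sub>R t) + g = m *\<^sub>R (s /\<^sub>R t)"
    proof -
      have "B *v (s /\<^sub>R t) + g = (B *v s + t *\<^sub>R g) /\<^sub>R t"
        using t0 by (simp add: matrix_vector_mult_scaleR scaleR_right_distrib)
      then show ?thesis
        by (simp add: eig1 mult.commute)
    qed
    ultimately show ?thesis
      by simp
  next
    case False
    with m0 have m: "m = 0"
      by simp
    have "0 \<le> - \<delta>"
      using lower[of "vec_append 0 1"] by (simp add: m hom_matrix_mult inner_vec_append)
    with \<delta> have \<delta>0: "\<delta> = 0"
      by simp
    \<comment> \<open>Since \<delta> is 0, the last coordinate vector also attains the minimal value
      0 and so lies in the kernel; the upper block of its image is \<open>g\<close>.\<close>
    have "?F *v vec_append 0 1 = m *\<^sub>R vec_append 0 1"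
      using lower by (intro quadratic_form_minimiser_eigenvector[OF transpose_hom_matrix[OF sym]])
        (auto simp: m \<delta>0 hom_matrix_mult inner_vec_append)
    then have "g = 0"
      by (simp add: hom_matrix_mult scaleR_vec_append m)
    with s_le \<delta>0 show ?thesis
      by simp
  qed
qed


section \<open>Affine scaling in the interior of the box\<close>

lemma diag_mult: "diag w *v y = (\<chi> i. w $ i * y $ i)"
proof -
  have "(\<Sum>j\<in>UNIV. (if i = j then w $ i else 0) * y $ j) = w $ i * y $ i" for i
    by (subst sum.cong[OF refl, of _ _ "\<lambda>j. if i = j then w $ i * y $ j else 0"]) auto
  then show ?thesis
    by (simp add: vec_eq_iff diag_def matrix_vector_mult_def)
qed

text \<open>Finite bounds are strict in the interior, and an infinite bound gives the default entry
  1 or -1.\<close>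

lemma scal_v_nonzero:
  assumes "y \<in> box_interior l u"
  shows "scal_v f l u y $ i \<noteq> 0"
proof -
  have "l $ i < ereal (y $ i)" "ereal (y $ i) < u $ i"
    using assms by (auto simp: box_interior_def)
  then show ?thesis
    by (cases "l $ i"; cases "u $ i") (auto simp: scal_v_def)
qed

text \<open>This allows an error vector to be written in scaled coordinates.\<close>

lemma scal_Dinv_surj:
  assumes "y \<in> box_interior l u"
  shows "\<exists>w. scal_Dinv f l u y *v w = e"
proof
  show "scal_Dinv f l u y *v (\<chi> i. e $ i / sqrt \<bar>scal_v f l u y $ i\<bar>) = e"
    using scal_v_nonzero[OF assms] by (simp add: scal_Dinv_def diag_mult vec_eq_iff)
qed

lemma scal_g_eq_0_iff:
  assumes "y \<in> box_interior l u"
  shows "scal_g f l u y = 0 \<longleftrightarrow> grad f y = 0"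
  using scal_v_nonzero[OF assms] by (simp add: scal_g_def scal_Dinv_def diag_mult vec_eq_iff)

text \<open>The matrix is diagonal, and each entry is a gradient component times 1, -1 or 0. Hence
  it is small near a stationary point.\<close>

lemma norm_scal_C_mult_le: "norm (scal_C f l u y *v z) \<le> norm (grad f y) * norm z"
proof -
  have "norm (scal_C f l u y *v z) \<le> norm (norm (grad f y) *\<^sub>R z)"
  proof (rule norm_le_componentwise_cart)
    fix i
    have "norm ((scal_C f l u y *v z) $ i) \<le> \<bar>grad f y $ i\<bar> * \<bar>z $ i\<bar>"
      by (simp add: scal_C_def scal_Jv_def diag_mult abs_mult flip: matrix_vector_mul_assoc)
    also have "\<dots> \<le> norm (grad f y) * \<bar>z $ i\<bar>"
      by (intro mult_right_mono component_le_norm_cart) auto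
    finally show "norm ((scal_C f l u y *v z) $ i) \<le> norm ((norm (grad f y) *\<^sub>R z) $ i)"
      by (simp add: abs_mult)
  qed
  then show ?thesis
    by simp
qed


section \<open>Local convergence\<close>

text \<open>In scaled coordinates the new error is \<open>q = d + w\<close>. The matrix
  \<open>B - C\<close> equals \<open>P H P\<close> and inherits coercivity with constant \<mu>/2
  because \<open>C\<close> is bounded by the gradient. It maps \<open>q\<close> to a sum of the
  shift \<open>m d\<close>, the term \<open>C d\<close> and the scaled remainder. When the gradient
  vanishes at \<open>a\<close>, \<rho> bounds the Taylor remainder.\<close>

lemma scaled_newton_step_bound:
  fixes f :: "real^'n \<Rightarrow> real" and l u :: "ereal^'n"
  defines "P \<equiv> scal_Dinv f l u" and "B \<equiv> scal_B f l u"
  assumes y: "y \<in> box_interior l u"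
    and coercive: "\<And>z. \<mu> * (z \<bullet> z) \<le> z \<bullet> (B y *v z)" and \<mu>: "0 < \<mu>"
    and P: "mnorm (P y) \<le> \<gamma>\<^sub>D"
    and rem: "norm (grad f y - hessian f y *v (y - a)) \<le> \<rho>"
    and g_small: "norm (grad f y) \<le> \<mu> / 2"
    and step: "B y *v d + scal_g f l u y = m *\<^sub>R d"
  shows "norm (y + P y *v d - a)
    \<le> \<gamma>\<^sub>D * (2 / \<mu> * (\<bar>m\<bar> * norm d + norm (grad f y) * norm d + \<gamma>\<^sub>D * \<rho>))"
proof -
  let ?H = "hessian f y" and ?C = "scal_C f l u y" and ?g = "grad f y"
  let ?r = "?g - ?H *v (y - a)"
  obtain w where w: "P y *v w = y - a"
    using scal_Dinv_surj[OF y] unfolding P_def by blast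
  define q where "q = d + w"
  have Pq: "P y *v q = y + P y *v d - a"
    by (simp add: q_def matrix_vector_right_distrib w)
  have Bz: "B y *v z = P y *v (?H *v (P y *v z)) + ?C *v z" for z
    by (simp add: B_def scal_B_def P_def matrix_vector_mult_add_rdistrib matrix_vector_mul_assoc
        matrix_mul_assoc)
  \<comment> \<open>On \<open>w\<close> the matrix \<open>B - C\<close> gives
    \<open>P H (y - a)\<close>; on \<open>d\<close> the step equation replaces \<open>B d\<close>.
    The two first-order terms combine into the remainder \<open>?r\<close>.\<close>
  have eq: "B y *v q - ?C *v q = m *\<^sub>R d - ?C *v d - P y *v ?r"
  proof -
    have "B y *v q - ?C *v q = (B y *v d - ?C *v d) + P y *v (?H *v (y - a))"
      by (simp add: Bz q_def matrix_vector_right_distrib w)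
    also have "B y *v d = m *\<^sub>R d - P y *v ?g"
      using step by (simp add: scal_g_def P_def algebra_simps)
    finally show ?thesis
      by (simp add: matrix_vector_mult_diff_distrib)
  qed
  have \<gamma>0: "0 \<le> \<gamma>\<^sub>D"
    using P onorm_pos_le[of "(*v) (P y)"] by (simp add: mnorm_def)
  have P_le: "norm (P y *v z) \<le> \<gamma>\<^sub>D * norm z" for z
    using norm_mult_le_mnorm[of "P y" z] mult_right_mono[OF P, of "norm z"] by simp
  have rhs: "norm (B y *v q - ?C *v q) \<le> \<bar>m\<bar> * norm d + norm ?g * norm d + \<gamma>\<^sub>D * \<rho>" (is "_ \<le> ?E")
  proof -
    have "norm (B y *v q - ?C *v q) \<le> norm (m *\<^sub>R d) + norm (?C *v d) + norm (P y *v ?r)"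
      unfolding eq by (meson add_mono norm_triangle_ineq4 order.refl order_trans)
    moreover have "norm (P y *v ?r) \<le> \<gamma>\<^sub>D * \<rho>"
      using P_le[of ?r] mult_left_mono[OF rem \<gamma>0] by linarith
    ultimately show ?thesis
      using norm_scal_C_mult_le[of f l u y d] by simp
  qed
  have "\<mu> / 2 * norm q \<le> norm (B y *v q - ?C *v q)"
  proof (cases "q = 0")
    case False
    have "q \<bullet> (?C *v q) \<le> norm q * norm (?C *v q)"
      by (rule norm_cauchy_schwarz)
    also have "\<dots> \<le> norm q * (\<mu> / 2 * norm q)"
      using norm_scal_C_mult_le[of f l u y q] mult_right_mono[OF g_small, of "norm q"]
      by (intro mult_left_mono) auto
    finally have "norm q * (\<mu> / 2 * norm q) \<le> q \<bullet> (B y *v q) - q \<bullet> (?C *v q)"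
      using coercive[of q] by (simp add: dot_square_norm power2_eq_square mult_ac)
    also have "\<dots> \<le> norm q * norm (B y *v q - ?C *v q)"
      unfolding inner_diff_right[symmetric] by (rule norm_cauchy_schwarz)
    finally show ?thesis
      using False by simp
  qed simp
  with rhs have "\<mu> / 2 * norm q \<le> ?E"
    by linarith
  then have "norm q \<le> 2 / \<mu> * ?E"
    using \<mu> by (simp add: field_simps)
  then show ?thesis
    using P_le[of q] mult_left_mono[OF _ \<gamma>0, of "norm q" "2 / \<mu> * ?E"] unfolding Pq by linarith
qed

lemma pos_semidef_diff_scaled_mat_coercive:
  fixes A :: "real^'n^'n"
  assumes "pos_semidef (A - \<mu> *\<^sub>R mat 1)"
  shows "\<mu> * (z \<bullet> z) \<le> z \<bullet> (A *v z)"
  using assms by (simp add: pos_semidef_def matrix_vector_mult_diff_rdistrib inner_diff_right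
      scaleR_matrix_vector_assoc[symmetric])

text \<open>Both outcomes of the subproblem fit one description: \<open>d = s / t\<close> in the
  small value case, and \<open>d = 0\<close> in the degenerate case, where the iterate does not move
  whatever step size is accepted.\<close>

lemma sobasip_step_cases:
  fixes f :: "real^'n \<Rightarrow> real"
  assumes sol: "subproblem_solution f l u \<delta> y s t"
    and step: "sobasip_step f l u \<nu> \<gamma> \<beta> \<tau> \<Delta> y s t y'"
    and psd: "pos_semidef (scal_B f l u y - \<mu> *\<^sub>R mat 1)"
    and pos: "0 < \<mu>" "0 \<le> \<delta>" "0 < \<Delta>" and g_small: "norm (scal_g f l u y) < \<Delta> * \<mu>"
  obtains d where "\<delta> = 0 \<or> small_value \<Delta> t" "y' = y + scal_Dinv f l u y *v d"
    "norm d \<le> norm (scal_g f l u y) / \<mu>"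
    "scal_B f l u y *v d + scal_g f l u y = (scal_g f l u y \<bullet> d - \<delta>) *\<^sub>R d"
proof -
  let ?B = "scal_B f l u y"
  have coercive: "\<mu> * (z \<bullet> z) \<le> z \<bullet> (?B *v z)" for z
    using psd by (rule pos_semidef_diff_scaled_mat_coercive)
  \<comment> \<open>Symmetry is part of \<open>pos_semidef\<close>, and subtracting a multiple of
    the identity does not affect it.\<close>
  have sym: "transpose ?B = ?B"
  proof -
    have eq: "transpose (?B - \<mu> *\<^sub>R mat 1) $ i $ j = (?B - \<mu> *\<^sub>R mat 1) $ i $ j" for i j
      using psd by (simp add: pos_semidef_def)
    have "?B $ j $ i = ?B $ i $ j" for i j
      using eq[of i j] by (cases "i = j") (simp_all add: transpose_def mat_def)
    then show ?thesis
      by (simp add: transpose_def vec_eq_iff)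
  qed
  from hom_subproblem_cases[OF sol[unfolded subproblem_solution_def] sym coercive pos g_small]
  show ?thesis
  proof (elim disjE conjE)
    assume "s = 0" "scal_g f l u y = 0" "\<delta> = 0"
    moreover from \<open>s = 0\<close> have "y' = y"
      using step by (auto simp: sobasip_step_def sobasip_dbar_def Let_def split: if_splits)
    ultimately show ?thesis
      by (intro that[of 0]) auto
  next
    assume "small_value \<Delta> t" "norm (s /\<^sub>R t) \<le> norm (scal_g f l u y) / \<mu>"
      "?B *v (s /\<^sub>R t) + scal_g f l u y = (scal_g f l u y \<bullet> (s /\<^sub>R t) - \<delta>) *\<^sub>R (s /\<^sub>R t)"
    moreover from \<open>small_value \<Delta> t\<close> have "y' = y + scal_Dinv f l u y *v (s /\<^sub>R t)"
      using step by (simp add: sobasip_step_def sobasip_dbar_def Let_def)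
    ultimately show ?thesis
      by (intro that[of "s /\<^sub>R t"]) auto
  qed
qed

lemma sobasip_delta_nonneg: "0 \<le> \<delta> \<Longrightarrow> 0 \<le> sobasip_delta \<Delta> \<delta> t k"
  by (induction k) auto

text \<open>A small value case at \<open>k\<close> resets the perturbation at \<open>Suc k\<close>,
  and a zero perturbation persists; hence the vanishing starts one index after the assumed
  alternative does.\<close>

lemma sobasip_delta_eventually_0:
  assumes "\<forall>\<^sub>F k in sequentially. sobasip_delta \<Delta> \<delta> t k = 0 \<or> small_value \<Delta> (t k)"
  shows "\<forall>\<^sub>F k in sequentially. sobasip_delta \<Delta> \<delta> t k = 0"
proof -
  obtain K where "\<And>k. k \<ge> K \<Longrightarrow> sobasip_delta \<Delta> \<delta> t k = 0 \<or> small_value \<Delta> (t k)"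
    using assms by (auto simp: eventually_sequentially)
  then have "sobasip_delta \<Delta> \<delta> t (Suc k) = 0" if "k \<ge> K" for k
    using that by auto
  then have "sobasip_delta \<Delta> \<delta> t k = 0" if "k \<ge> Suc K" for k
    using that by (cases k) (auto simp del: sobasip_delta.simps)
  then show ?thesis
    unfolding eventually_sequentially by blast
qed

theorem theorem2:
  fixes f :: "real^'n \<Rightarrow> real"
    and l u :: "ereal^'n"
    and \<nu> \<gamma> \<beta> \<tau> \<Delta> \<delta> :: real
    and x s :: "nat \<Rightarrow> real^'n"
    and t :: "nat \<Rightarrow> real"
    and X :: "(real^'n) set"
    and xstar :: "real^'n"
    and L\<^sub>H U\<^sub>H \<gamma>\<^sub>D \<gamma>\<^sub>B r \<mu> L\<^sub>D :: real
  assumes bounds: "\<And>i. l $ i \<noteq> \<infinity>" "\<And>i. u $ i \<noteq> -\<infinity>" "\<And>i. l $ i < u $ i"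
    and params: "0 < \<nu>" "\<nu> < 1/2" "0 < \<gamma>" "0 < \<beta>" "\<beta> < 1" "0 < \<tau>" "\<tau> < 1" "0 < \<Delta>" "0 \<le> \<delta>"
    and run: "sobasip_run f l u \<nu> \<gamma> \<beta> \<tau> \<Delta> \<delta> x s t"
    and A1: "bounded X" "closed X" "X \<subseteq> box_interior l u" "\<And>k. x k \<in> X"
    and A2: "Ck_on 3 f X"
      "0 < L\<^sub>H" "\<And>y z. y \<in> X \<Longrightarrow> z \<in> X \<Longrightarrow> mnorm (hessian f y - hessian f z) \<le> L\<^sub>H * norm (y - z)"
      "0 < U\<^sub>H" "\<And>k. mnorm (hessian f (x k)) \<le> U\<^sub>H"
    and A3: "0 < \<gamma>\<^sub>D" "\<And>k. mnorm (scal_Dinv f l u (x k)) \<le> \<gamma>\<^sub>D"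
      "0 < \<gamma>\<^sub>B" "\<And>k. mnorm (scal_B f l u (x k)) \<le> \<gamma>\<^sub>B"
    and A4: "x \<longlonglongrightarrow> xstar" "strict_local_min_on f (box_feasible l u) xstar"
      "scal_g f l u xstar = 0" "pos_def (scal_B f l u xstar)"
      "0 < r" "0 < \<mu>" "\<And>y. y \<in> cball xstar r \<Longrightarrow> pos_semidef (scal_B f l u y - \<mu> *\<^sub>R mat 1)"
    and A5: "0 < L\<^sub>D"
      "\<And>y z. y \<in> cball xstar r \<Longrightarrow> z \<in> cball xstar r \<Longrightarrow>
         mnorm (scal_Dinv f l u y - scal_Dinv f l u z) \<le> L\<^sub>D * norm (y - z)"
  shows "(\<lambda>k. norm (x (Suc k) - xstar)) \<in> O(\<lambda>k. (norm (x k - xstar))\<^sup>2)"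
proof -
  let ?g = "\<lambda>k. grad f (x k)" and ?gb = "\<lambda>k. scal_g f l u (x k)"
  let ?e = "\<lambda>k. norm (x k - xstar)"
  have xstar: "xstar \<in> X"
    using A1 A4(1) closed_sequentially by blast
  then have "grad f xstar = 0"
    using A1(3) A4(3) scal_g_eq_0_iff by blast
  with grad_taylor[OF A2(1) xstar] obtain K where K: "0 \<le> K"
    "\<forall>\<^sub>F y in nhds xstar. norm (grad f y - hessian f y *v (y - xstar)) \<le> K * (norm (y - xstar))\<^sup>2"
    by auto
  have taylor: "\<forall>\<^sub>F k in sequentially. norm (?g k - hessian f (x k) *v (x k - xstar)) \<le> K * (?e k)\<^sup>2"
    by (rule eventually_compose_filterlim[OF K(2) A4(1)])
  have e0: "?e \<longlonglongrightarrow> 0"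
    using A4(1) by (simp add: LIM_zero tendsto_norm_zero)
  then have e_less: "\<forall>\<^sub>F k in sequentially. ?e k < c" if "c > 0" for c
    using that by (rule order_tendstoD)
  \<comment> \<open>First-order constant for the gradient: the Hessian term contributes
    \<open>U\<^sub>H\<close>, and the quadratic remainder contributes \<open>K\<close> once the
    error is below 1.\<close>
  define G where "G = U\<^sub>H + K"
  have G: "0 < G"
    using A2(4) K(1) by (simp add: G_def)
  have g_le: "\<forall>\<^sub>F k in sequentially. norm (?g k) \<le> G * ?e k"
    using taylor e_less[OF zero_less_one]
  proof eventually_elim
    case (elim k)
    have "norm (?g k) \<le> norm (hessian f (x k) *v (x k - xstar)) + K * (?e k)\<^sup>2"
      using elim(1) norm_triangle_sub[of "?g k" "hessian f (x k) *v (x k - xstar)"] by linarith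
    also have "norm (hessian f (x k) *v (x k - xstar)) \<le> U\<^sub>H * ?e k"
      using norm_mult_le_mnorm mult_right_mono[OF A2(5), of "?e k"] by (meson norm_ge_zero order_trans)
    also have "K * (?e k)\<^sup>2 \<le> K * ?e k"
      using elim(2) K(1) by (intro mult_left_mono) (auto simp: power2_eq_square mult_left_le)
    finally show ?case
      by (simp add: G_def algebra_simps)
  qed
  have gb_le': "norm (?gb k) \<le> \<gamma>\<^sub>D * norm (?g k)" for k
    unfolding scal_g_def
    using norm_mult_le_mnorm mult_right_mono[OF A3(2), of "norm (?g k)"] by (meson norm_ge_zero order_trans)
  have gb_le: "\<forall>\<^sub>F k in sequentially. norm (?gb k) \<le> \<gamma>\<^sub>D * G * ?e k"
    using g_le
  proof eventually_elim
    case (elim k)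
    then show ?case
      using order_trans[OF gb_le' mult_left_mono[OF elim, of \<gamma>\<^sub>D]] A3(1) by (simp add: mult.assoc)
  qed
  have psd: "\<forall>\<^sub>F k in sequentially. pos_semidef (scal_B f l u (x k) - \<mu> *\<^sub>R mat 1)"
    using e_less[OF A4(5)]
    by eventually_elim (intro A4(7), simp add: dist_norm norm_minus_commute)
  have step_ex: "\<forall>\<^sub>F k in sequentially. \<exists>d.
      (sobasip_delta \<Delta> \<delta> t k = 0 \<or> small_value \<Delta> (t k)) \<and>
      x (Suc k) = x k + scal_Dinv f l u (x k) *v d \<and> norm d \<le> norm (?gb k) / \<mu> \<and>
      scal_B f l u (x k) *v d + ?gb k = (?gb k \<bullet> d - sobasip_delta \<Delta> \<delta> t k) *\<^sub>R d"
  proof -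
    \<comment> \<open>Below this error the scaled gradient is smaller than \<Delta>\<mu>, the
      threshold for the subproblem dichotomy.\<close>
    have "0 < \<Delta> * \<mu> / (\<gamma>\<^sub>D * G)"
      using params A4 A3 G by simp
    from gb_le psd e_less[OF this] show ?thesis
    proof eventually_elim
      case (elim k)
      have "\<gamma>\<^sub>D * G * ?e k < \<Delta> * \<mu>"
        using elim(3) A3(1) G by (simp add: field_simps)
      with elim(1) have gs: "norm (?gb k) < \<Delta> * \<mu>"
        by simp
      have r: "subproblem_solution f l u (sobasip_delta \<Delta> \<delta> t k) (x k) (s k) (t k)"
        "sobasip_step f l u \<nu> \<gamma> \<beta> \<tau> \<Delta> (x k) (s k) (t k) (x (Suc k))"
        using run by (auto simp: sobasip_run_def)
      show ?case
        using sobasip_step_cases[OF r elim(2) A4(6) sobasip_delta_nonneg[OF params(9)] params(8) gs]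
        by metis
    qed
  qed
  \<comment> \<open>The step description holds for any current perturbation. Its first clause now
    shows that the perturbation eventually vanishes, after which the shift is just the inner product
    of the scaled gradient and \<open>d\<close>.\<close>
  then have "\<forall>\<^sub>F k in sequentially. sobasip_delta \<Delta> \<delta> t k = 0 \<or> small_value \<Delta> (t k)"
    by eventually_elim blast
  then have delta: "\<forall>\<^sub>F k in sequentially. sobasip_delta \<Delta> \<delta> t k = 0"
    by (rule sobasip_delta_eventually_0)
  define N where "N = \<gamma>\<^sub>D * G / \<mu>"
  \<comment> \<open>The summands come from the shift, from \<open>C d\<close> and from the Taylor
    remainder; \<open>N\<close> bounds the ratio of \<open>norm d\<close> to the error.\<close>
  define M where "M = \<gamma>\<^sub>D * (2 / \<mu> * (\<gamma>\<^sub>D * G * N * N + G * N + \<gamma>\<^sub>D * K))"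
  have N: "0 < N"
    using A3 A4 G by (simp add: N_def)
  \<comment> \<open>Below this error the gradient is at most \<mu>/2, as coercivity of
    \<open>B - C\<close> requires.\<close>
  have "0 < \<mu> / (2 * G)"
    using A4 G by simp
  note small = e_less[OF this]
  have "\<forall>\<^sub>F k in sequentially. norm (x (Suc k) - xstar) \<le> M * (?e k)\<^sup>2"
    using step_ex delta taylor g_le gb_le psd small e_less[OF zero_less_one]
  proof eventually_elim
    case (elim k)
    then obtain d where d: "x (Suc k) = x k + scal_Dinv f l u (x k) *v d"
      "norm d \<le> norm (?gb k) / \<mu>"
      "scal_B f l u (x k) *v d + ?gb k = (?gb k \<bullet> d) *\<^sub>R d"
      by auto
    let ?e = "norm (x k - xstar)"
    have dN: "norm d \<le> N * ?e"
      using d(2) divide_right_mono[OF elim(5), of \<mu>] A4(6) by (simp add: N_def)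
    have "\<bar>?gb k \<bullet> d\<bar> \<le> norm (?gb k) * norm d"
      by (rule Cauchy_Schwarz_ineq2)
    also have "\<dots> \<le> (\<gamma>\<^sub>D * G * ?e) * (N * ?e)"
      using elim(5) dN A3 G by (intro mult_mono) auto
    \<comment> \<open>The shift is of second order, but a first-order bound suffices, since it is
      multiplied by \<open>norm d\<close>.\<close>
    also have "\<dots> \<le> (\<gamma>\<^sub>D * G * ?e) * (N * 1)"
      using elim(8) A3 G N by (intro mult_left_mono) auto
    finally have m: "\<bar>?gb k \<bullet> d\<bar> \<le> \<gamma>\<^sub>D * G * N * ?e"
      by (simp add: mult_ac)
    have coercive: "\<mu> * (z \<bullet> z) \<le> z \<bullet> (scal_B f l u (x k) *v z)" for z
      using elim(6) by (rule pos_semidef_diff_scaled_mat_coercive)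
    have gs: "norm (?g k) \<le> \<mu> / 2"
      using elim(4,7) G by (simp add: field_simps)
    have "norm (x (Suc k) - xstar) \<le> \<gamma>\<^sub>D * (2 / \<mu> * (\<bar>?gb k \<bullet> d\<bar> * norm d + norm (?g k) * norm d
        + \<gamma>\<^sub>D * (K * ?e\<^sup>2)))"
      unfolding d(1) using A1(3,4)
      by (intro scaled_newton_step_bound coercive A4(6) A3(2) elim(3) gs d(3)) auto
    also have "\<dots> \<le> \<gamma>\<^sub>D * (2 / \<mu> * ((\<gamma>\<^sub>D * G * N * ?e) * (N * ?e) + (G * ?e) * (N * ?e)
        + \<gamma>\<^sub>D * (K * ?e\<^sup>2)))"
    proof -
      have "\<bar>?gb k \<bullet> d\<bar> * norm d \<le> (\<gamma>\<^sub>D * G * N * ?e) * (N * ?e)"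
        using m dN A3(1) G N by (intro mult_mono) auto
      moreover have "norm (?g k) * norm d \<le> (G * ?e) * (N * ?e)"
        using elim(4) dN G by (intro mult_mono) auto
      ultimately show ?thesis
        using A3(1) A4(6) by (intro mult_left_mono) auto
    qed
    also have "\<dots> = M * ?e\<^sup>2"
      by (simp add: M_def algebra_simps power2_eq_square)
    finally show ?case .
  qed
  then show ?thesis
    by (intro bigoI[of _ M]) simp
qed

end
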